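(* Let $(\leq_A)_{A \subseteq S}$ be a family of binary relations on acts satisfying postulates (Q1)--(Q6), and let $\leq$ be the relation on events defined by it. For any event $A \subseteq S$, $\emptyset \leq A$.
   Context: $S$ is a non-empty set of states, $F$ a set of consequences; events are arbitrary subsets of $S$; acts are arbitrary functions $S \to F$. For each event $A$ a binary relation $\leq_A$ on acts is given. Write $f \sim_A g$ for ($f \leq_A g$ and $g \leq_A f$), $f <_A g$ for ($f \leq_A g$ and not $g \leq_A f$), and $f =_A g$ if $f(s)=g(s)$ for all $s \in A$. An event $A$ is null if $h \leq_A h'$ for all acts $h,h'$. For disjoint $A,B$, write $A \,\mathcal{N}\, B$ if for all acts $h,h'$: $h \leq_{A\cup B} h' \Leftrightarrow h \leq_B h'$. A consequence $c\in F$ is identified with the constant act with value $c$. For consequences, $c \leq d$ (without subscript) means $c \leq_B d$ for every event $B$ (under (Q5), if some event is non-null, this is equivalent to $c \leq_A d$ for one, equivalently every, non-null $A$), and $d < c$ means $d \leq c$ and not $c \leq d$. $w_A^{c,d}$ is the act with value $c$ on $A$ and $d$ on $S \setminus A$. Postulates (for all acts $f,g,h$ and events $A,B$): (Q1) $f \leq_A g$ and $g \leq_A h$ imply $f \leq_A h$. (Q2) $f =_A g$ implies $f \sim_A g$. (Q3) if $A \cap B = \emptyset$, $f \leq_A g$ and $f \sim_B g$, then $f \leq_{A \cup B} g$. (Q4) if $A \cap B = \emptyset$, $f \leq_{A\cup B} g$ and $f \sim_B g$, then either $f \leq_A g$ or $A \,\mathcal{N}\, B$. (Q5) if $c,d$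 are constant acts, $A$ is not null and $c \leq_A d$, then $c \leq_B d$ for every event $B$. (Q6) there are consequences $c,d$ with $d < c$. Relation on events defined by the family: for events $A,B$, $A \leq B$ iff for all consequences $c,d$ with $d < c$, $w_A^{c,d} \leq_{A\cup B} w_B^{c,d}$. *)

theory Defs imports Main begin

text \<open>
  States are the elements of the type \<open>'s\<close> (so \<open>S\<close> is \<open>UNIV\<close>, non-empty like every type),
  consequences those of \<open>'f\<close>; events are sets of states, and acts are functions
  \<open>'s \<Rightarrow> 'f\<close>. In a family \<open>R\<close> of relations, \<open>R A f g\<close> stands for \<open>f \<le>\<^sub>A g\<close>.
\<close>

type_synonym ('s, 'f) act = "'s \<Rightarrow> 'f"
type_synonym ('s, 'f) pref_family = "'s set \<Rightarrow> ('s, 'f) act \<Rightarrow> ('s, 'f) act \<Rightarrow> bool"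

definition act_indiff :: "('s, 'f) pref_family \<Rightarrow> 's set \<Rightarrow> ('s, 'f) act \<Rightarrow> ('s, 'f) act \<Rightarrow> bool"
  where "act_indiff R A f g \<longleftrightarrow> R A f g \<and> R A g f"

definition eq_act_on :: "'s set \<Rightarrow> ('s, 'f) act \<Rightarrow> ('s, 'f) act \<Rightarrow> bool"
  where "eq_act_on A f g \<longleftrightarrow> (\<forall>s\<in>A. f s = g s)"

definition null_event :: "('s, 'f) pref_family \<Rightarrow> 's set \<Rightarrow> bool"
  where "null_event R A \<longleftrightarrow> (\<forall>h h'. R A h h')"

text \<open>The relation \<open>A \<N> B\<close>, only meant for disjoint \<open>A\<close> and \<open>B\<close>.\<close>

definition negligible_wrt :: "('s, 'f) pref_family \<Rightarrow> 's set \<Rightarrow> 's set \<Rightarrow> bool"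
  where "negligible_wrt R A B \<longleftrightarrow> (\<forall>h h'. R (A \<union> B) h h' \<longleftrightarrow> R B h h')"

definition const_act :: "'f \<Rightarrow> ('s, 'f) act"
  where "const_act c = (\<lambda>s. c)"

definition conseq_le :: "('s, 'f) pref_family \<Rightarrow> 'f \<Rightarrow> 'f \<Rightarrow> bool"
  where "conseq_le R c d \<longleftrightarrow> (\<forall>B. R B (const_act c) (const_act d))"

definition conseq_less :: "('s, 'f) pref_family \<Rightarrow> 'f \<Rightarrow> 'f \<Rightarrow> bool"
  where "conseq_less R d c \<longleftrightarrow> conseq_le R d c \<and> \<not> conseq_le R c d"

text \<open>\<open>bet A c d\<close> is the act \<open>w\<close> with superscripts \<open>c\<close>, \<open>d\<close> and subscript \<open>A\<close>.\<close>

definition bet :: "'s set \<Rightarrow> 'f \<Rightarrow> 'f \<Rightarrow> ('s, 'f) act"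
  where "bet A c d = (\<lambda>s. if s \<in> A then c else d)"

definition event_le :: "('s, 'f) pref_family \<Rightarrow> 's set \<Rightarrow> 's set \<Rightarrow> bool"
  where "event_le R A B \<longleftrightarrow>
    (\<forall>c d. conseq_less R d c \<longrightarrow> R (A \<union> B) (bet A c d) (bet B c d))"

locale Q_postulates =
  fixes R :: "('s, 'f) pref_family"
  assumes Q1: "\<And>A f g h. R A f g \<Longrightarrow> R A g h \<Longrightarrow> R A f h"
    and Q2: "\<And>A f g. eq_act_on A f g \<Longrightarrow> act_indiff R A f g"
    and Q3: "\<And>A B f g. A \<inter> B = {} \<Longrightarrow> R A f g \<Longrightarrow> act_indiff R B f g \<Longrightarrow> R (A \<union> B) f g"
    and Q4: "\<And>A B f g. A \<inter> B = {} \<Longrightarrow> R (A \<union> B) f g \<Longrightarrow> act_indiff R B f g \<Longrightarrow>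
      R A f g \<or> negligible_wrt R A B"
    and Q5: "\<And>A B c d. \<not> null_event R A \<Longrightarrow> R A (const_act c) (const_act d) \<Longrightarrow>
      R B (const_act c) (const_act d)"
    and Q6: "\<exists>c d. conseq_less R d c"

end

theory Submission imports Defs begin

text \<open>The bet on the empty event pays \<open>d\<close> everywhere, while the bet on
  \<open>A\<close> agrees with the constant \<open>c\<close> on \<open>A\<close>, so by (Q2) the two
  are indifferent given \<open>A\<close>. As \<open>d < c\<close> includes \<open>d\<close> \<le>
  \<open>c\<close> given every event, in particular \<open>A\<close>, transitivity (Q1) ranks the
  two bets.\<close>

theorem lemma10:
  fixes R :: "('s, 'f) pref_family" and A :: "'s set"
  assumes "Q_postulates R"
  shows "event_le R {} A"
proof -
  interpret Q_postulates R by fact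
  show ?thesis
    unfolding event_le_def
  proof (intro allI impI)
    fix c d assume "conseq_less R d c"
    then have "R A (const_act d) (const_act c)"
      by (simp add: conseq_less_def conseq_le_def)
    \<comment> \<open>The two acts can differ only off \<open>A\<close>, where preference given
      \<open>A\<close> is blind by (Q2).\<close>
    moreover have "R A (const_act c) (bet A c d)"
      using Q2[of A "const_act c" "bet A c d"]
      by (simp add: act_indiff_def eq_act_on_def const_act_def bet_def)
    ultimately have "R A (const_act d) (bet A c d)"
      by (rule Q1)
    moreover have "bet {} c d = (const_act d :: ('s, 'f) act)"
      by (simp add: bet_def const_act_def)
    ultimately show "R ({} \<union> A) (bet {} c d) (bet A c d)"
      by simp
  qed
qed

end
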